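(* For every integer $n\geq 3$, the matrix $\mathbb{J}_{n}=\mathrm{circ}(J_{1},J_{2},\ldots ,J_{n})$ is invertible.
   Context: The Jacobsthal numbers are defined by $J_0=0$, $J_1=1$, $J_{k}=J_{k-1}+2J_{k-2}$ for $k\ge 2$. For numbers $c_0,\dots,c_{n-1}$, $\mathrm{circ}(c_0,c_1,\ldots,c_{n-1})$ denotes the $n\times n$ circulant matrix whose first row is $(c_0,c_1,\ldots,c_{n-1})$ and each of whose later rows is the cyclic right shift by one of the row above; i.e. the $(i,j)$ entry ($1\le i,j\le n$) is $c_{(j-i)\bmod n}$. In particular $\mathrm{circ}(J_1,\dots,J_n)$ has first row $(J_1,J_2,\dots,J_n)$. *)

theory Defs
  imports Complex_Main "Jordan_Normal_Form.Matrix"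
begin

fun jacobsthal :: "nat \<Rightarrow> nat" where
  "jacobsthal 0 = 0"
| "jacobsthal (Suc 0) = 1"
| "jacobsthal (Suc (Suc k)) = jacobsthal (Suc k) + 2 * jacobsthal k"

(* The argument is the first row. Rows and columns are indexed from 0; the index j - i
   is reduced modulo n in int, because subtraction on nat truncates. *)
definition circ :: "'a list \<Rightarrow> 'a mat" where
  "circ cs = (let n = length cs in
     mat n n (\<lambda>(i, j). cs ! nat ((int j - int i) mod int n)))"

end

theory Submission
  imports Defs "Jordan_Normal_Form.Determinant"
begin

text \<open>Let \<open>v\<close> be a kernel vector, extended to an \<open>n\<close>-periodic sequence. The windowed sums
  \<open>S i = (\<Sum>k<n. J (k + 1) * v (i + k))\<close> all vanish, and by the Jacobsthal recurrence
  \<open>S i - S (i + 1) - 2 * S (i + 2)\<close> telescopes to \<open>(1 - J (n + 1)) * v i - 2 * J n * v (i + 1)\<close>.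
  So \<open>v\<close> is geometric with a negative real ratio \<open>r\<close>, and periodicity forces \<open>v = 0\<close> unless
  \<open>r = -1\<close> and \<open>n\<close> is even. In that case \<open>S 0\<close> is \<open>v 0\<close> times the alternating sum of
  \<open>J 1, \<dots>, J n\<close>, which is nonzero for even \<open>n > 2\<close> (it vanishes for \<open>n = 2\<close>).\<close>

lemma jacobsthal_pos: "k > 0 \<Longrightarrow> jacobsthal k > 0"
  by (induction k rule: jacobsthal.induct) auto

text \<open>Follows from the closed form \<open>3 * J k = 2 ^ k - (-1) ^ k\<close>, with two terms
  added per induction step; the factor 9 clears denominators.\<close>

lemma alternating_jacobsthal_sum:
  "9 * (\<Sum>k<2 * m. (-1) ^ k * real (jacobsthal (Suc k))) = 6 * real m + 2 - 2 * 4 ^ m"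
proof (induction m)
  case (Suc m)
  have J: "3 * real (jacobsthal k) = 2 ^ k - (-1) ^ k" for k
    by (induction k rule: jacobsthal.induct) auto
  have "4 ^ m = (2::real) ^ (2 * m)"
    by (simp add: power_mult)
  then show ?case
    using Suc J[of "Suc (2 * m)"] J[of "Suc (Suc (2 * m))"] by simp
qed simp

lemma alternating_jacobsthal_sum_nonzero:
  assumes "even n" "n \<ge> 3"
  shows "(\<Sum>k<n. (-1) ^ k * real (jacobsthal (Suc k))) \<noteq> 0"
proof -
  obtain m where m: "n = 2 * m" "m \<ge> 2"
    using assms by (auto elim!: evenE)
  \<comment> \<open>Equality holds at \<open>m = 0\<close> and \<open>m = 1\<close>, so the
    induction starts at 2.\<close>
  have "3 * real m + 1 < 4 ^ m"
    using m(2) by (induction m rule: dec_induct) auto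
  then show ?thesis
    using alternating_jacobsthal_sum[of m] m(1) by auto
qed

text \<open>Passing from \<open>n\<close> to \<open>n + 1\<close> adds
  \<open>J (n + 1) * (w (i + n) - w (i + n + 1) - 2 * w (i + n + 2))\<close>; the recurrence for
  \<open>J (n + 2)\<close> absorbs this into the boundary terms.\<close>

lemma jacobsthal_window_telescope:
  fixes w :: "nat \<Rightarrow> real"
  defines "S \<equiv> \<lambda>n i. \<Sum>k<n. real (jacobsthal (Suc k)) * w (i + k)"
  shows "S n i - S n (i + 1) - 2 * S n (i + 2) =
    w i - real (jacobsthal (Suc n)) * w (i + n) - 2 * real (jacobsthal n) * w (i + n + 1)"
proof (induction n)
  case (Suc n)
  then show ?case
    by (simp add: S_def algebra_simps)
qed (simp add: S_def)

lemma negative_power_eq_1: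
  fixes r :: real
  assumes "r < 0" "n > 0" "r ^ n = 1"
  shows "r = -1" "even n"
proof -
  have "\<bar>r\<bar> = 1"
    using power_eq_1_iff[OF assms(3)] assms(2) by simp
  then show "r = -1"
    using assms(1) by simp
  then show "even n"
    using assms(3) by (cases "even n") auto
qed

lemma periodic_jacobsthal_window_zero:
  fixes w :: "nat \<Rightarrow> real"
  assumes "n \<ge> 3" and per: "\<And>i. w (i + n) = w i"
    and S: "\<And>i. (\<Sum>k<n. real (jacobsthal (Suc k)) * w (i + k)) = 0"
  shows "w i = 0"
proof -
  \<comment> \<open>The ratio comes from solving the telescoped identity, with
    \<open>w (i + n) = w i\<close>, for \<open>w (i + 1)\<close>.\<close>
  define r where "r = (1 - real (jacobsthal (Suc n))) / (2 * real (jacobsthal n))"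
  have Jn: "real (jacobsthal n) > 0"
    using jacobsthal_pos assms(1) by simp
  \<comment> \<open>Two unfoldings give \<open>J (n + 1) = 3 * J (m + 1) + 2 * J m > 1\<close>, so
    the numerator of \<open>r\<close> is negative.\<close>
  obtain m where "n = Suc (Suc m)" "m > 0"
    using assms(1) by (metis Suc_le_D Suc_le_mono numeral_3_eq_3 zero_less_Suc)
  then have "real (jacobsthal (Suc n)) > 1"
    using jacobsthal_pos[of m] jacobsthal_pos[of "Suc m"] by simp
  then have "r < 0"
    using Jn by (simp add: r_def divide_neg_pos)
  have step: "w (Suc i) = r * w i" for i
  proof -
    have "w i - real (jacobsthal (Suc n)) * w i - 2 * real (jacobsthal n) * w (Suc i) = 0"
      using jacobsthal_window_telescope[where w = w and n = n and i = i] per[of i] per[of "Suc i"]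
      unfolding S by simp
    then show ?thesis
      using Jn by (simp add: r_def field_simps)
  qed
  have geo: "w (i + k) = r ^ k * w i" for i k
    by (induction k) (auto simp: step)
  show ?thesis
  proof (rule ccontr)
    assume "w i \<noteq> 0"
    then have "r ^ n = 1"
      using geo[of i n] per[of i] by simp
    moreover have "n > 0"
      using assms(1) by simp
    ultimately have "r = -1" "even n"
      using negative_power_eq_1 \<open>r < 0\<close> by blast+
    have "(\<Sum>k<n. (-1) ^ k * real (jacobsthal (Suc k))) * w i =
        (\<Sum>k<n. real (jacobsthal (Suc k)) * w (i + k))"
      unfolding geo \<open>r = -1\<close> sum_distrib_right by (intro sum.cong) auto
    then show False
      using alternating_jacobsthal_sum_nonzero[OF \<open>even n\<close> assms(1)] \<open>w i \<noteq> 0\<close>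
      unfolding S by (metis mult_eq_0_iff)
  qed
qed

text \<open>Substituting \<open>k = (j - i) mod n\<close> moves the cyclic shift from the
  coefficients to the vector, turning each row product into a windowed sum.\<close>

lemma circ_mult_vec:
  fixes v :: "'a :: comm_semiring_0 vec"
  assumes "dim_vec v = length cs" "i < length cs"
  shows "(circ cs *\<^sub>v v) $ i = (\<Sum>k<length cs. cs ! k * v $ ((i + k) mod length cs))"
proof -
  let ?n = "length cs"
  have n: "int ?n > 0"
    using assms(2) by linarith
  have "(circ cs *\<^sub>v v) $ i = (\<Sum>j\<in>{0..<?n}. cs ! nat ((int j - int i) mod int ?n) * v $ j)"
    using assms by (simp add: circ_def Let_def scalar_prod_def)
  also have "\<dots> = (\<Sum>k<?n. cs ! k * v $ ((i + k) mod ?n))"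
  proof (rule sum.reindex_bij_witness
      [of _ "\<lambda>k. (i + k) mod ?n" "\<lambda>j. nat ((int j - int i) mod int ?n)"])
    fix j assume j: "j \<in> {0..<?n}"
    have "int ((i + nat ((int j - int i) mod int ?n)) mod ?n) = int j"
      using n j by (simp add: zmod_int mod_add_right_eq)
    then show inv: "(i + nat ((int j - int i) mod int ?n)) mod ?n = j"
      by linarith
    show "nat ((int j - int i) mod int ?n) \<in> {..<?n}"
      using n by (simp add: nat_less_iff)
    show "cs ! nat ((int j - int i) mod int ?n) *
        v $ ((i + nat ((int j - int i) mod int ?n)) mod ?n) =
      cs ! nat ((int j - int i) mod int ?n) * v $ j"
      by (simp add: inv)
  next
    fix k assume k: "k \<in> {..<?n}"
    then show "nat ((int ((i + k) mod ?n) - int i) mod int ?n) = k"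
      by (simp add: zmod_int mod_diff_left_eq)
    show "(i + k) mod ?n \<in> {0..<?n}"
      using n by simp
  qed
  finally show ?thesis .
qed

text \<open>A trivial kernel forces a nonzero determinant, hence a unit of the matrix ring.\<close>

lemma invertible_mat_if_kernel_trivial:
  fixes A :: "'a :: field mat"
  assumes A: "A \<in> carrier_mat n n"
    and ker: "\<And>v. v \<in> carrier_vec n \<Longrightarrow> A *\<^sub>v v = 0\<^sub>v n \<Longrightarrow> v = 0\<^sub>v n"
  shows "invertible_mat A"
proof -
  have "det A \<noteq> 0"
    using det_0_iff_vec_prod_zero[OF A] ker by blast
  from det_non_zero_imp_unit[OF A this] show ?thesis
    using A unfolding Units_def ring_mat_def invertible_mat_def inverts_mat_def by auto
qed

theorem theorem3:
  fixes n :: nat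
  assumes "n \<ge> 3"
  shows "invertible_mat (circ (map (\<lambda>k. real (jacobsthal k)) [1..<n + 1]))"
proof (rule invertible_mat_if_kernel_trivial[where n = n])
  let ?cs = "map (\<lambda>k. real (jacobsthal k)) [1..<n + 1]"
  show "circ ?cs \<in> carrier_mat n n"
    using assms by (simp add: circ_def Let_def)
  fix v :: "real vec"
  assume v: "v \<in> carrier_vec n" and ker: "circ ?cs *\<^sub>v v = 0\<^sub>v n"
  \<comment> \<open>The periodic extension needs this for every natural \<open>i\<close>; reducing
    \<open>i\<close> modulo \<open>n\<close> selects an actual row.\<close>
  have "(\<Sum>k<n. real (jacobsthal (Suc k)) * v $ ((i + k) mod n)) = 0" for i
  proof -
    have "i mod n < n"
      using assms by simp
    then have "(circ ?cs *\<^sub>v v) $ (i mod n) = 0"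
      using ker by simp
    moreover have "(circ ?cs *\<^sub>v v) $ (i mod n) =
      (\<Sum>k<n. ?cs ! k * v $ ((i mod n + k) mod n))"
      using circ_mult_vec[of v ?cs "i mod n"] v \<open>i mod n < n\<close> by simp
    moreover have "\<dots> = (\<Sum>k<n. real (jacobsthal (Suc k)) * v $ ((i + k) mod n))"
      by (intro sum.cong) (auto simp del: upt_Suc simp: mod_add_left_eq)
    ultimately show ?thesis
      by simp
  qed
  moreover have "v $ ((i + n) mod n) = v $ (i mod n)" for i
    by simp
  ultimately have "v $ (i mod n) = 0" for i
    using periodic_jacobsthal_window_zero[OF assms, of "\<lambda>i. v $ (i mod n)"] by blast
  then have "v $ i = 0" if "i < n" for i
    using that by (metis mod_less)
  then show "v = 0\<^sub>v n"
    using v by (intro eq_vecI) simp_all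
qed

end
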